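(* Let $n\ge4$ be an integer, and let $x,\beta,\gamma$ be real numbers with $$x\ge0,\qquad\beta,\gamma\ge0,\qquad\beta+\gamma\le1.$$ Then $\mathcal R_{n,x}(\beta,\gamma)\ge0$, and equality holds if and only if $\beta=\gamma=0$.
   Context: $$\begin{aligned}\mathcal R_{n,x}(\beta,\gamma)={}&(x^2-x-1)\beta^2+(4x^2-x-2)\beta\gamma+(4x^2-1)\gamma^2\\&+\bigl((n-2)x^2+(2n-1)x+n\bigr)\beta+\bigl((2n-8)x^2+(3n-2)x+n\bigr)\gamma.\end{aligned}$$ Here $n$ stands for the real dimension of the underlying manifold. *)

theory Defs
  imports Complex_Main
begin

definition R_poly :: "nat \<Rightarrow> real \<Rightarrow> real \<Rightarrow> real \<Rightarrow> real" where
  "R_poly n x \<beta> \<gamma> =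
     (x^2 - x - 1) * \<beta>^2 + (4 * x^2 - x - 2) * \<beta> * \<gamma> + (4 * x^2 - 1) * \<gamma>^2
     + ((real n - 2) * x^2 + (2 * real n - 1) * x + real n) * \<beta>
     + ((2 * real n - 8) * x^2 + (3 * real n - 2) * x + real n) * \<gamma>"

end

theory Submission
  imports Defs
begin

text \<open>
  Collected by powers of \<open>x\<close>, the polynomial has three coefficients that can be seen to be
  nonnegative separately: the quadratic terms in \<open>\<beta>, \<gamma>\<close> group into \<open>(\<beta> + 2\<gamma>)\<^sup>2\<close>,
  \<open>- \<beta>(\<beta> + \<gamma>)\<close> and \<open>- (\<beta> + \<gamma>)\<^sup>2\<close>, and the two negative ones are dominated by the linear terms
  because \<open>\<beta> + \<gamma> \<le> 1\<close>. The constant coefficient \<open>(\<beta> + \<gamma>)(n - (\<beta> + \<gamma>))\<close> is even at least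
  \<open>3(\<beta> + \<gamma>)\<close>, and this lower bound for the whole polynomial settles the equality case.
\<close>

lemma R_poly_by_powers_of_x:
  "R_poly n x \<beta> \<gamma> =
     ((\<beta> + 2 * \<gamma>)^2 + (real n - 2) * \<beta> + (2 * real n - 8) * \<gamma>) * x^2
     + (\<beta> * (2 * real n - 1 - (\<beta> + \<gamma>)) + (3 * real n - 2) * \<gamma>) * x
     + (\<beta> + \<gamma>) * (real n - (\<beta> + \<gamma>))"
  unfolding R_poly_def by (simp add: algebra_simps power2_eq_square)

text \<open>
  The hypothesis \<open>n \<ge> 4\<close> is what makes the term \<open>(2n - 8)\<gamma>\<close> in the leading coefficient
  nonnegative.
\<close>
lemma R_poly_lower_bound:
  assumes "n \<ge> 4" and "x \<ge> 0" and "\<beta> \<ge> 0" and "\<gamma> \<ge> 0" and "\<beta> + \<gamma> \<le> 1"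
  shows "R_poly n x \<beta> \<gamma> \<ge> 3 * \<beta> + 3 * \<gamma>"
proof -
  have n: "real n \<ge> 4" using \<open>n \<ge> 4\<close> by simp
  have "((\<beta> + 2 * \<gamma>)^2 + (real n - 2) * \<beta> + (2 * real n - 8) * \<gamma>) * x^2 \<ge> 0"
    using n assms by (intro mult_nonneg_nonneg add_nonneg_nonneg) auto
  moreover have "(\<beta> * (2 * real n - 1 - (\<beta> + \<gamma>)) + (3 * real n - 2) * \<gamma>) * x \<ge> 0"
    using n assms by (intro mult_nonneg_nonneg add_nonneg_nonneg) auto
  moreover have "(\<beta> + \<gamma>) * (real n - (\<beta> + \<gamma>)) \<ge> (\<beta> + \<gamma>) * 3"
    using n assms by (intro mult_left_mono) auto
  ultimately show ?thesis
    unfolding R_poly_by_powers_of_x by argo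
qed

theorem theorem2p9:
  fixes n :: nat and x \<beta> \<gamma> :: real
  assumes "n \<ge> 4"
    and "x \<ge> 0"
    and "\<beta> \<ge> 0" and "\<gamma> \<ge> 0"
    and "\<beta> + \<gamma> \<le> 1"
  shows "R_poly n x \<beta> \<gamma> \<ge> 0 \<and> (R_poly n x \<beta> \<gamma> = 0 \<longleftrightarrow> \<beta> = 0 \<and> \<gamma> = 0)"
proof (intro conjI iffI)
  note bound = R_poly_lower_bound[OF assms]
  show "R_poly n x \<beta> \<gamma> \<ge> 0"
    using bound assms(3,4) by linarith
  show "\<beta> = 0" if "R_poly n x \<beta> \<gamma> = 0"
    using that bound assms(3,4) by linarith
  show "\<gamma> = 0" if "R_poly n x \<beta> \<gamma> = 0"
    using that bound assms(3,4) by linarith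
  show "R_poly n x \<beta> \<gamma> = 0" if "\<beta> = 0 \<and> \<gamma> = 0"
    using that by (simp add: R_poly_def)
qed

end
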